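(* Let $K\subseteq \mathbb{R}^d$ be compact and let $\Gamma \subseteq \mathbb{R}^d$ be such that $\mathcal{E}(\Gamma)$ is complete in $L^2(K-K)$. Further, let $g \in C(\mathbb{R}^d)$ and let $\Lambda \subseteq \mathbb{R}^d$ be such that $\mathcal{T}(g_\omega,\Lambda)$ is complete in $C(K)$ for every $\omega \in K-K$. Then $\Lambda \times \Gamma$ is a uniqueness set for phase retrieval in $L^2(K)$ with window $g$.
   Context: $C(\mathbb{R}^d)$ denotes the continuous functions $\mathbb{R}^d\to\mathbb{C}$; $C(K)$ denotes the continuous complex-valued functions on $K$ with the maximum norm. $K-K=\{k-k' : k,k'\in K\}$ is the Minkowski difference. $L^2(K)$ is identified with the subspace $\{f\in L^2(\mathbb{R}^d): \mathrm{supp}(f)\subseteq K\}$ of $L^2(\mathbb{R}^d)$ (complex-valued functions, Lebesgue measure). For $\Gamma\subseteq\mathbb{R}^d$, $\mathcal{E}(\Gamma)=\{e^{2\pi i\gamma\cdot t}:\gamma\in\Gamma\}$ is the system of complex exponentials (as functions of $t$). For $f:\mathbb{R}^d\to\mathbb{C}$ and $\lambda\in\mathbb{R}^d$, $T_\lambda f=f(\cdot-\lambda)$, and for $\Lambda\subseteq\mathbb{R}^d$, $\mathcal{T}(f,\Lambda)=\{T_\lambda f:\lambda\in\Lambda\}$. A system of functions is complete in a Banach space $X$ of functions on a set $S\subseteq\mathbb{R}^d$ if the restrictions of its members to $S$ belong to $X$ and the complex linear span of these restrictions is dense in $X$. For $g:\mathbb{R}^d\to\mathbb{C}$ and $\omega\in\mathbb{R}^d$,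 $g_\omega(t)=g(t-\omega)\overline{g(t)}$. The short-time Fourier transform of $f$ with window $g$ is $V_gf(x,\xi)=\int_{\mathbb{R}^d}f(t)\overline{g(t-x)}e^{-2\pi i\xi\cdot t}\,dt$ for $x,\xi\in\mathbb{R}^d$; it is well defined pointwise for $f,g\in L^2(\mathbb{R}^d)$, and also for $f\in L^2(K)$ with $K$ compact and $g\in C(\mathbb{R}^d)$. A set $U\subseteq\mathbb{R}^{2d}$ is a uniqueness set for phase retrieval in $X\subseteq L^2(\mathbb{R}^d)$ with window $g$ if, whenever $f,h\in X$ satisfy $|V_gf(u)|=|V_gh(u)|$ for all $u\in U$, there is $c\in\mathbb{C}$ with $|c|=1$ and $f=ch$. *)

theory Defs
  imports "HOL-Analysis.Analysis" "HOL-Library.Function_Algebras"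
begin

interpretation cfun: vector_space "\<lambda>(c::complex) (f :: 'a \<Rightarrow> complex) t. c * f t"
  by unfold_locales (simp_all add: fun_eq_iff algebra_simps)

(* Minkowski difference; the minus sign on sets is set difference in HOL. *)
definition minkowski_diff :: "'a::ab_group_add set \<Rightarrow> 'a set \<Rightarrow> 'a set" where
  "minkowski_diff A B = {a - b | a b. a \<in> A \<and> b \<in> B}"

(* Support of a function modulo null sets: the complement of the largest open set on which
   the function vanishes almost everywhere. *)
definition ess_supp :: "('a::euclidean_space \<Rightarrow> complex) \<Rightarrow> 'a set" where
  "ess_supp f = - \<Union>{U. open U \<and> (AE t in lebesgue. t \<in> U \<longrightarrow> f t = 0)}"

(* Elements of L2 are represented by functions, not by equivalence classes; equality in L2 is
   equality almost everywhere. *)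
definition L2 :: "('a::euclidean_space \<Rightarrow> complex) set" where
  "L2 = {f. f \<in> borel_measurable lebesgue \<and> integrable lebesgue (\<lambda>t. (norm (f t))\<^sup>2)}"

definition L2_norm :: "('a::euclidean_space \<Rightarrow> complex) \<Rightarrow> real" where
  "L2_norm f = sqrt (LINT t|lebesgue. (norm (f t))\<^sup>2)"

definition L2_on :: "'a::euclidean_space set \<Rightarrow> ('a \<Rightarrow> complex) set" where
  "L2_on S = {f \<in> L2. ess_supp f \<subseteq> S}"

(* A function on S is represented by its extension by zero. *)
definition restrict0 :: "'a set \<Rightarrow> ('a \<Rightarrow> complex) \<Rightarrow> 'a \<Rightarrow> complex" where
  "restrict0 S f = (\<lambda>t. if t \<in> S then f t else 0)"

definition C_on :: "'a::euclidean_space set \<Rightarrow> ('a \<Rightarrow> complex) set" where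
  "C_on S = {f. continuous_on S f \<and> (\<forall>t. t \<notin> S \<longrightarrow> f t = 0)}"

(* The maximum norm on a compact S; inserting 0 gives the value 0 when S is empty. *)
definition max_norm :: "'a set \<Rightarrow> ('a \<Rightarrow> complex) \<Rightarrow> real" where
  "max_norm S f = Sup (insert 0 ((\<lambda>t. norm (f t)) ` S))"

(* X is a space of functions on S (extended by zero) with norm nrm. *)
definition complete_system ::
  "'a set \<Rightarrow> ('a \<Rightarrow> complex) set \<Rightarrow> (('a \<Rightarrow> complex) \<Rightarrow> real) \<Rightarrow> ('a \<Rightarrow> complex) set \<Rightarrow> bool" where
  "complete_system S X nrm F \<longleftrightarrow>
     restrict0 S ` F \<subseteq> X \<and>
     (\<forall>f\<in>X. \<forall>\<epsilon>>0. \<exists>p\<in>cfun.span (restrict0 S ` F). nrm (\<lambda>t. f t - p t) < \<epsilon>)"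

abbreviation complete_in_L2 :: "'a::euclidean_space set \<Rightarrow> ('a \<Rightarrow> complex) set \<Rightarrow> bool" where
  "complete_in_L2 S \<equiv> complete_system S (L2_on S) L2_norm"

abbreviation complete_in_C :: "'a::euclidean_space set \<Rightarrow> ('a \<Rightarrow> complex) set \<Rightarrow> bool" where
  "complete_in_C S \<equiv> complete_system S (C_on S) (max_norm S)"

definition exponentials :: "'a::euclidean_space set \<Rightarrow> ('a \<Rightarrow> complex) set" where
  "exponentials \<Gamma> = (\<lambda>\<gamma> t. exp (2 * of_real pi * \<i> * of_real (\<gamma> \<bullet> t))) ` \<Gamma>"

definition translation :: "'a::euclidean_space \<Rightarrow> ('a \<Rightarrow> complex) \<Rightarrow> 'a \<Rightarrow> complex" where
  "translation l f = (\<lambda>t. f (t - l))"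

definition translates :: "('a::euclidean_space \<Rightarrow> complex) \<Rightarrow> 'a set \<Rightarrow> ('a \<Rightarrow> complex) set" where
  "translates f \<Lambda> = (\<lambda>l. translation l f) ` \<Lambda>"

definition shift_product :: "('a::euclidean_space \<Rightarrow> complex) \<Rightarrow> 'a \<Rightarrow> 'a \<Rightarrow> complex" where
  "shift_product g \<omega> = (\<lambda>t. g (t - \<omega>) * cnj (g t))"

definition stft :: "('a::euclidean_space \<Rightarrow> complex) \<Rightarrow> ('a \<Rightarrow> complex) \<Rightarrow> 'a \<times> 'a \<Rightarrow> complex" where
  "stft g f = (\<lambda>(x, \<xi>). LINT t|lebesgue.
     f t * cnj (g (t - x)) * exp (- 2 * of_real pi * \<i> * of_real (\<xi> \<bullet> t)))"

definition phase_retrieval_uniqueness_set ::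
  "('a::euclidean_space \<Rightarrow> complex) \<Rightarrow> ('a \<Rightarrow> complex) set \<Rightarrow> ('a \<times> 'a) set \<Rightarrow> bool" where
  "phase_retrieval_uniqueness_set g X U \<longleftrightarrow>
     (\<forall>f\<in>X. \<forall>h\<in>X. (\<forall>u\<in>U. norm (stft g f u) = norm (stft g h u)) \<longrightarrow>
        (\<exists>c. norm c = 1 \<and> (AE t in lebesgue. f t = c * h t)))"

lemma AE_outside_ess_supp:
  fixes f :: "'a::euclidean_space \<Rightarrow> complex"
  shows "AE t in lebesgue. t \<notin> ess_supp f \<longrightarrow> f t = 0"
proof -
  let ?\<U> = "{U. open U \<and> (AE t in lebesgue. t \<in> U \<longrightarrow> f t = 0)}"
  obtain \<V> where V: "\<V> \<subseteq> ?\<U>" "countable \<V>" "\<Union>\<V> = \<Union>?\<U>"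
    using Lindelof[of ?\<U>] by auto
  have "AE t in lebesgue. \<forall>U\<in>\<V>. t \<in> U \<longrightarrow> f t = 0"
    using V by (subst AE_ball_countable) auto
  then have "AE t in lebesgue. t \<in> \<Union>\<V> \<longrightarrow> f t = 0"
    by (rule eventually_mono) blast
  then show ?thesis
    unfolding ess_supp_def V(3) by (simp only: Compl_iff not_not)
qed

lemma ess_supp_subset_iff:
  fixes f :: "'a::euclidean_space \<Rightarrow> complex"
  assumes "closed S"
  shows "ess_supp f \<subseteq> S \<longleftrightarrow> (AE t in lebesgue. t \<notin> S \<longrightarrow> f t = 0)"
proof
  assume "ess_supp f \<subseteq> S"
  with AE_outside_ess_supp[of f] show "AE t in lebesgue. t \<notin> S \<longrightarrow> f t = 0"
    by (rule_tac eventually_mono) auto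
next
  assume "AE t in lebesgue. t \<notin> S \<longrightarrow> f t = 0"
  then have "- S \<in> {U. open U \<and> (AE t in lebesgue. t \<in> U \<longrightarrow> f t = 0)}"
    using assms by (simp add: open_Compl)
  then show "ess_supp f \<subseteq> S"
    unfolding ess_supp_def by blast
qed

end

theory Submission
  imports Defs
begin

text \<open>
  Phase retrieval from the short-time Fourier transform linearises through autocorrelations. For
  \<open>f\<close> supported in \<open>K\<close> put \<open>F(t) = f(t) cnj(g(t - l))\<close>. The squared modulus of the transform at
  \<open>(l, \<gamma>)\<close> is the Fourier transform at \<open>\<gamma>\<close> of the autocorrelation
  \<open>s \<mapsto> \<integral> F(t) cnj(F(t - s)) dt\<close> (\<open>fourier_autocorrelation\<close>), a bounded function supported in \<open>K - K\<close>.
  If \<open>f\<close> and \<open>h\<close> give the same measurements, then for every \<open>l\<close> in \<open>\<Lambda>\<close> the difference of the two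
  autocorrelations is orthogonal to the exponentials with frequencies in \<open>\<Gamma>\<close>, hence zero almost
  everywhere (\<open>bounded_orthogonal_exponentials_zero\<close>).

  Written out, that difference at \<open>s\<close> is the integral of
  \<open>\<phi>\<^sub>s(t) = f(t) cnj(f(t - s)) - h(t) cnj(h(t - s))\<close> against the translate by \<open>l\<close> of the function
  \<open>shift_product g s\<close>. It depends continuously on \<open>l\<close>, so a countable dense subset of \<open>\<Lambda>\<close> shows that
  for almost every \<open>s\<close> it vanishes for all \<open>l\<close> in \<open>\<Lambda>\<close> at once. For such an \<open>s\<close> in \<open>K - K\<close>, completeness
  of the translates in the continuous functions on \<open>K\<close> yields \<open>\<phi>\<^sub>s = 0\<close> almost everywhere
  (\<open>integrable_zero_if_orthogonal_translates\<close>); for \<open>s\<close> outside \<open>K - K\<close> it is zero trivially.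

  Interchanging the two almost-everywhere quantifiers and substituting \<open>u = t - s\<close> gives
  \<open>f(t) cnj(f(u)) = h(t) cnj(h(u))\<close> for almost all \<open>u\<close> and \<open>t\<close>
  (\<open>equal_spectrograms_imp_equal_kernels\<close>), and a rank-one kernel determines its function up to a
  unimodular constant (\<open>rank_one_kernel_determines_function\<close>).
\<close>

section \<open>Reflections and translations of Lebesgue measure\<close>

lemma lborel_distr_reflect:
  fixes t :: "'a::euclidean_space"
  shows "distr lborel borel (\<lambda>s. t - s) = lborel"
  by (subst (2) lborel_affine[of "-1" t]) (auto simp: density_1)

lemma integral_lborel_reflect:
  fixes F :: "'a::euclidean_space \<Rightarrow> 'b::{banach, second_countable_topology}"
  assumes [measurable]: "F \<in> borel_measurable borel"
  shows "(LINT s|lborel. F (t - s)) = (LINT s|lborel. F s)"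
  by (subst (2) lborel_distr_reflect[of t, symmetric], subst integral_distr) auto

lemma integrable_lborel_reflect:
  fixes F :: "'a::euclidean_space \<Rightarrow> 'b::{banach, second_countable_topology}"
  assumes "integrable lborel F"
  shows "integrable lborel (\<lambda>s. F (t - s))"
  using assms by (subst integrable_distr_eq[where N = borel, symmetric]) (auto simp: lborel_distr_reflect)

lemma integral_lborel_translate:
  fixes F :: "'a::euclidean_space \<Rightarrow> 'b::{banach, second_countable_topology}"
  assumes [measurable]: "F \<in> borel_measurable borel"
  shows "(LINT t|lborel. F (t - s)) = (LINT t|lborel. F t)"
  by (subst (2) lborel_distr_plus[of "- s", symmetric], subst integral_distr) auto

lemma integrable_lborel_translate:
  fixes F :: "'a::euclidean_space \<Rightarrow> 'b::{banach, second_countable_topology}"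
  assumes "integrable lborel F"
  shows "integrable lborel (\<lambda>t. F (t - s))"
proof -
  have "integrable lborel (\<lambda>t. F (- s + t))"
    using assms by (subst integrable_distr_eq[where N = borel, symmetric]) (auto simp: lborel_distr_plus)
  then show ?thesis by simp
qed

section \<open>Autocorrelations and their Fourier transforms\<close>

lemma cnj_measurable [measurable]: "cnj \<in> borel_measurable borel"
  by (intro borel_measurable_continuous_onI continuous_intros)

definition autocorrelation :: "('a::euclidean_space \<Rightarrow> complex) \<Rightarrow> 'a \<Rightarrow> complex" where
  "autocorrelation F s = (LINT t|lborel. F t * cnj (F (t - s)))"

definition plane_wave :: "'a::euclidean_space \<Rightarrow> 'a \<Rightarrow> complex" where
  "plane_wave \<xi> t = exp (2 * of_real pi * \<i> * of_real (\<xi> \<bullet> t))"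

lemma plane_wave_measurable [measurable]: "plane_wave \<xi> \<in> borel_measurable borel"
  unfolding plane_wave_def[abs_def] by measurable

lemma norm_plane_wave [simp]: "norm (plane_wave \<xi> t) = 1"
proof -
  have "plane_wave \<xi> t = exp (\<i> * of_real (2 * pi * (\<xi> \<bullet> t)))"
    by (simp add: plane_wave_def algebra_simps)
  then show ?thesis by (simp only: norm_exp_i_times)
qed

lemma cnj_plane_wave: "cnj (plane_wave \<xi> t) = exp (- 2 * of_real pi * \<i> * of_real (\<xi> \<bullet> t))"
  by (simp add: plane_wave_def exp_cnj)

lemma plane_wave_diff: "plane_wave \<xi> (t - s) = plane_wave \<xi> t * cnj (plane_wave \<xi> s)"
  unfolding cnj_plane_wave unfolding plane_wave_def exp_add[symmetric] by (simp add: algebra_simps inner_diff_right)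

lemma plane_wave_mult_cnj [simp]: "plane_wave \<xi> t * cnj (plane_wave \<xi> t) = 1"
  unfolding complex_norm_square[symmetric] by simp

lemma norm_mult_cnj_le: "norm (a * cnj b) \<le> (norm a)\<^sup>2 + (norm b)\<^sup>2" for a b :: complex
proof -
  have "2 * (norm a * norm b) \<le> (norm a)\<^sup>2 + (norm b)\<^sup>2"
    using sum_squares_bound[of "norm a" "norm b"] by simp
  moreover have "0 \<le> norm a * norm b" by simp
  ultimately show ?thesis unfolding norm_mult complex_mod_cnj by linarith
qed

lemma integrable_shifted_square:
  fixes F :: "'a::euclidean_space \<Rightarrow> complex"
  assumes [measurable]: "F \<in> borel_measurable borel"
    and sq: "integrable lborel (\<lambda>t. (norm (F t))\<^sup>2)"
  shows "integrable lborel (\<lambda>t. F t * cnj (F (t - s)))"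
proof (rule Bochner_Integration.integrable_bound)
  show "integrable lborel (\<lambda>t. (norm (F t))\<^sup>2 + (norm (F (t - s)))\<^sup>2)"
    using sq integrable_lborel_translate[OF sq] by (intro Bochner_Integration.integrable_add)
qed (auto intro: order.trans[OF norm_mult_cnj_le])

text \<open>The integrand is at most \<open>|F(t)|\<^sup>2 + |F(t - s)|\<^sup>2\<close>, whose integral does not depend on \<open>s\<close>. The bound
serves to place autocorrelations of compactly supported functions in \<open>L2\<close>.\<close>

lemma norm_autocorrelation_le:
  fixes F :: "'a::euclidean_space \<Rightarrow> complex"
  assumes [measurable]: "F \<in> borel_measurable borel"
    and sq: "integrable lborel (\<lambda>t. (norm (F t))\<^sup>2)"
  shows "norm (autocorrelation F s) \<le> 2 * (LINT t|lborel. (norm (F t))\<^sup>2)"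
proof -
  have "norm (autocorrelation F s) \<le> (LINT t|lborel. norm (F t * cnj (F (t - s))))"
    unfolding autocorrelation_def by (rule integral_norm_bound)
  also have "\<dots> \<le> (LINT t|lborel. (norm (F t))\<^sup>2 + (norm (F (t - s)))\<^sup>2)"
    using integrable_shifted_square[OF assms, of s] sq integrable_lborel_translate[OF sq, of s]
    by (intro integral_mono norm_mult_cnj_le) auto
  also have "\<dots> = 2 * (LINT t|lborel. (norm (F t))\<^sup>2)"
    using sq integrable_lborel_translate[OF sq, of s]
      integral_lborel_translate[of "\<lambda>t. (norm (F t))\<^sup>2" s] by simp
  finally show ?thesis .
qed

lemma autocorrelation_measurable [measurable]:
  fixes F :: "'a::euclidean_space \<Rightarrow> complex"
  assumes [measurable]: "F \<in> borel_measurable borel"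
  shows "autocorrelation F \<in> borel_measurable borel"
  unfolding autocorrelation_def[abs_def] by measurable

lemma autocorrelation_outside:
  assumes "\<And>t. t \<notin> K \<Longrightarrow> F t = 0" and "s \<notin> minkowski_diff K K"
  shows "autocorrelation F s = 0"
proof -
  have "F t * cnj (F (t - s)) = 0" for t
  proof (rule ccontr)
    assume "F t * cnj (F (t - s)) \<noteq> 0"
    then have "t \<in> K" "t - s \<in> K" using assms(1) by auto
    then have "s \<in> minkowski_diff K K"
      unfolding minkowski_diff_def mem_Collect_eq
      by (intro exI[of _ t] exI[of _ "t - s"]) simp
    then show False using assms(2) by simp
  qed
  then show ?thesis by (simp only: autocorrelation_def integral_zero)
qed

text \<open>Modulation moves inside the autocorrelation: for \<open>H = F \<cdot> cnj (plane_wave \<xi>)\<close> one has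
\<open>F(t) cnj(F(t - s)) cnj(plane_wave \<xi> s) = H(t) cnj(H(t - s))\<close>. Integrating first in \<open>s\<close> decouples the
two factors and leaves the squared modulus of the integral of \<open>H\<close>. This is how the phaseless
measurements become linear in the autocorrelation.\<close>

lemma
  fixes F :: "'a::euclidean_space \<Rightarrow> complex"
  assumes F: "integrable lborel F"
  shows integrable_autocorrelation_wave:
      "integrable lborel (\<lambda>s. autocorrelation F s * cnj (plane_wave \<xi> s))" (is ?I)
    and fourier_autocorrelation: "(LINT s|lborel. autocorrelation F s * cnj (plane_wave \<xi> s)) =
      of_real ((norm (LINT t|lborel. F t * cnj (plane_wave \<xi> t)))\<^sup>2)" (is ?F)
proof -
  define H where "H t = F t * cnj (plane_wave \<xi> t)" for t
  have [measurable]: "F \<in> borel_measurable borel" using F by auto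
  then have [measurable]: "H \<in> borel_measurable borel" unfolding H_def[abs_def] by measurable
  have H: "integrable lborel H"
    unfolding H_def by (rule Bochner_Integration.integrable_bound[OF F]) (auto simp: norm_mult)
  have eq: "F t * cnj (F (t - s)) * cnj (plane_wave \<xi> s) = H t * cnj (H (t - s))" for t s
  proof -
    have "H t * cnj (H (t - s)) = F t * cnj (F (t - s)) *
        (plane_wave \<xi> t * cnj (plane_wave \<xi> t)) * cnj (plane_wave \<xi> s)"
      unfolding H_def plane_wave_diff by (simp add: algebra_simps)
    then show ?thesis by simp
  qed
  have inner: "integrable lborel (\<lambda>s. H t * cnj (H (t - s)))" for t
    using integrable_lborel_reflect[OF H] by simp
  have "(LINT s|lborel. norm (H t * cnj (H (t - s)))) = norm (H t) * (LINT s|lborel. norm (H s))" for t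
    using integral_lborel_reflect[of "\<lambda>s. norm (H s)" t] by (simp add: norm_mult)
  then have int: "integrable (lborel \<Otimes>\<^sub>M lborel) (\<lambda>(t, s). H t * cnj (H (t - s)))"
    using H inner by (intro lborel_pair.Fubini_integrable) auto
  have wave: "autocorrelation F s * cnj (plane_wave \<xi> s) = (LINT t|lborel. H t * cnj (H (t - s)))" for s
    unfolding autocorrelation_def by (subst integral_mult_left_zero[symmetric]) (simp only: eq)
  show ?I unfolding wave using lborel_pair.integrable_snd[OF int] .
  have "(LINT s|lborel. autocorrelation F s * cnj (plane_wave \<xi> s)) =
      (LINT s|lborel. LINT t|lborel. H t * cnj (H (t - s)))"
    unfolding wave ..
  also have "\<dots> = (LINT t|lborel. LINT s|lborel. H t * cnj (H (t - s)))"
    by (rule lborel_pair.Fubini_integral[OF int])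
  also have "\<dots> = (LINT t|lborel. H t * cnj (LINT s|lborel. H s))"
    using integral_lborel_reflect[of H] by simp
  also have "\<dots> = (LINT t|lborel. H t) * cnj (LINT t|lborel. H t)"
    by simp
  also have "\<dots> = of_real ((norm (LINT t|lborel. H t))\<^sup>2)"
    by (simp only: complex_norm_square)
  finally show ?F unfolding H_def .
qed

section \<open>Functions orthogonal to a complete system\<close>

text \<open>Span induction with the vector space operations on functions unfolded pointwise, so that
properties formulated with integrals of the function values can be substituted for \<open>P\<close>.\<close>

lemma span_induct_functions:
  assumes "p \<in> cfun.span B" and "P (\<lambda>t. 0)"
    and "\<And>c b p. b \<in> B \<Longrightarrow> P p \<Longrightarrow> P (\<lambda>t. c * b t + p t)"
  shows "P p"
  using assms(1)
proof (induction rule: cfun.span_induct_alt)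
  case base
  then show ?case using assms(2) by (simp add: zero_fun_def)
next
  case (step c x y)
  then show ?case using assms(3)[of x y c] by (simp add: plus_fun_def)
qed

text \<open>If \<open>D\<close> is orthogonal to the system, it is orthogonal to every \<open>p\<close> in the span, whence
\<open>\<parallel>D - p\<parallel>\<^sup>2 = \<parallel>D\<parallel>\<^sup>2 + \<parallel>p\<parallel>\<^sup>2 \<ge> \<parallel>D\<parallel>\<^sup>2\<close>; completeness makes the left-hand side arbitrarily small.
Restricting to bounded functions keeps all products integrable over the compact set \<open>S\<close>.\<close>

lemma bounded_orthogonal_exponentials_zero:
  fixes D :: "'a::euclidean_space \<Rightarrow> complex"
  assumes S: "compact S" and compl: "complete_in_L2 S (exponentials \<Gamma>)"
    and D[measurable]: "D \<in> borel_measurable borel"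
    and bnd: "\<And>s. norm (D s) \<le> B" and out: "\<And>s. s \<notin> S \<Longrightarrow> D s = 0"
    and orth: "\<And>\<gamma>. \<gamma> \<in> \<Gamma> \<Longrightarrow> (LINT s|lborel. D s * cnj (plane_wave \<gamma> s)) = 0"
  shows "AE s in lborel. D s = 0"
proof -
  have [measurable]: "S \<in> sets borel" using S by (simp add: borel_compact)
  \<comment> \<open>Functions of this kind form an algebra of integrable functions that contains the span and \<open>D\<close>.\<close>
  define adm where "adm p \<longleftrightarrow> p \<in> borel_measurable borel \<and> (\<exists>B. \<forall>s. norm (p s) \<le> B) \<and>
    (\<forall>s. s \<notin> S \<longrightarrow> p s = 0)" for p :: "'a \<Rightarrow> complex"
  have int: "integrable lborel p" if p: "adm p" for p
  proof -
    obtain B where B: "\<And>s. norm (p s) \<le> B" using p unfolding adm_def by blast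
    have "integrable lborel (\<lambda>s. B * indicator S s)"
      using emeasure_compact_finite[OF S] by (intro integrable_mult_right) simp
    then show ?thesis
    proof (rule Bochner_Integration.integrable_bound)
      show "AE s in lborel. norm (p s) \<le> norm (B * indicator S s)"
      proof (rule AE_I2)
        fix s show "norm (p s) \<le> norm (B * indicator S s :: real)"
          using p B[of s] unfolding adm_def by (cases "s \<in> S") auto
      qed
    qed (use p in \<open>auto simp: adm_def\<close>)
  qed
  have adm_mult: "adm (\<lambda>s. p s * cnj (q s))" if p: "adm p" and q: "adm q" for p q
  proof -
    obtain B C where "\<And>s. norm (p s) \<le> B" "\<And>s. norm (q s) \<le> C"
      using p q unfolding adm_def by blast
    then have "norm (p s * cnj (q s)) \<le> B * C" for s
      unfolding norm_mult complex_mod_cnj by (meson mult_mono' norm_ge_zero)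
    then have "\<exists>B. \<forall>s. norm (p s * cnj (q s)) \<le> B" by blast
    with p q show ?thesis unfolding adm_def by auto
  qed
  have adm_D: "adm D" using D bnd out unfolding adm_def by blast
  have adm_lin: "adm (\<lambda>s. c * p s + q s)" if p: "adm p" and q: "adm q" for c p q
  proof -
    obtain B C where BC: "\<And>s. norm (p s) \<le> B" "\<And>s. norm (q s) \<le> C"
      using p q unfolding adm_def by blast
    have "norm (c * p s + q s) \<le> norm c * B + C" for s
      using BC[of s] norm_triangle_ineq[of "c * p s" "q s"] mult_left_mono[of "norm (p s)" B "norm c"]
      by (simp add: norm_mult)
    then have "\<exists>B. \<forall>s. norm (c * p s + q s) \<le> B" by blast
    with p q show ?thesis unfolding adm_def by auto
  qed
  have adm_norm2: "integrable lborel (\<lambda>s. (norm (p s))\<^sup>2)" if "adm p" for p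
  proof -
    have "integrable lborel (\<lambda>s. norm (p s * cnj (p s)))"
      by (intro integrable_norm int adm_mult that)
    then show ?thesis by (simp add: norm_mult power2_eq_square)
  qed
  have wave: "adm (restrict0 S (plane_wave \<gamma>))" for \<gamma>
  proof -
    have "norm (restrict0 S (plane_wave \<gamma>) s) \<le> 1" for s by (simp add: restrict0_def)
    moreover have "restrict0 S (plane_wave \<gamma>) \<in> borel_measurable borel"
      unfolding restrict0_def by measurable
    ultimately show ?thesis unfolding adm_def by (auto simp: restrict0_def)
  qed
  have span: "adm p \<and> (LINT s|lborel. D s * cnj (p s)) = 0"
    if "p \<in> cfun.span (restrict0 S ` exponentials \<Gamma>)" for p
  proof (rule span_induct_functions
      [OF that, where P = "\<lambda>p. adm p \<and> (LINT s|lborel. D s * cnj (p s)) = 0"], goal_cases)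
    case 1
    show ?case by (auto simp: adm_def)
  next
    case (2 c b p)
    then obtain \<gamma> where \<gamma>: "\<gamma> \<in> \<Gamma>" "b = restrict0 S (plane_wave \<gamma>)"
      unfolding exponentials_def plane_wave_def[abs_def] by auto
    have b: "adm b" using wave \<gamma> by simp
    have "(\<lambda>s. D s * cnj (b s)) = (\<lambda>s. D s * cnj (plane_wave \<gamma> s))"
      using out by (auto simp: \<gamma>(2) restrict0_def)
    then have "(LINT s|lborel. D s * cnj (b s)) = 0" using orth[OF \<gamma>(1)] by simp
    moreover have "(LINT s|lborel. D s * cnj (c * b s + p s)) =
        (LINT s|lborel. cnj c * (D s * cnj (b s)) + D s * cnj (p s))"
      by (simp add: algebra_simps)
    moreover have "\<dots> = cnj c * (LINT s|lborel. D s * cnj (b s)) + (LINT s|lborel. D s * cnj (p s))"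
      using int[OF adm_mult[OF adm_D b]] int[OF adm_mult[OF adm_D, of p]] 2 by simp
    ultimately show ?case using 2 b adm_lin[of b p c] by simp
  qed
  have mem: "D \<in> L2_on S"
  proof -
    have "ess_supp D \<subseteq> S"
      using out by (subst ess_supp_subset_iff) (auto intro: compact_imp_closed[OF S])
    moreover have "D \<in> borel_measurable lebesgue" using D by (simp add: measurable_completion)
    moreover have "integrable lebesgue (\<lambda>t. (norm (D t))\<^sup>2)"
      using adm_norm2[OF adm_D] by (subst integrable_completion) auto
    ultimately show ?thesis unfolding L2_on_def L2_def by simp
  qed
  let ?I = "LINT s|lborel. (norm (D s))\<^sup>2"
  have small: "?I < \<epsilon>\<^sup>2" if \<epsilon>: "\<epsilon> > 0" for \<epsilon>
  proof -
    obtain p where p: "p \<in> cfun.span (restrict0 S ` exponentials \<Gamma>)"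
      and close: "L2_norm (\<lambda>t. D t - p t) < \<epsilon>"
      using compl mem \<epsilon> unfolding complete_system_def by blast
    have p': "adm p" "(LINT s|lborel. D s * cnj (p s)) = 0" using span[OF p] by auto
    then have [measurable]: "p \<in> borel_measurable borel" by (simp add: adm_def)
    have "(LINT s|lborel. (norm (D s - p s))\<^sup>2) =
        (LINT s|lborel. ((norm (D s))\<^sup>2 + (norm (p s))\<^sup>2) - 2 * Re (D s * cnj (p s)))"
    proof (rule Bochner_Integration.integral_cong)
      fix s show "(norm (D s - p s))\<^sup>2 = ((norm (D s))\<^sup>2 + (norm (p s))\<^sup>2) - 2 * Re (D s * cnj (p s))"
        unfolding cmod_power2 by (simp add: power2_eq_square algebra_simps)
    qed simp
    also have "\<dots> = ?I + (LINT s|lborel. (norm (p s))\<^sup>2) - 2 * Re (LINT s|lborel. D s * cnj (p s))"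
      using adm_norm2[OF adm_D] adm_norm2[OF p'(1)] int[OF adm_mult[OF adm_D p'(1)]]
      by (simp del: times_complex.sel)
    finally have "(LINT s|lborel. (norm (D s - p s))\<^sup>2) \<ge> ?I"
      using p'(2) by simp
    moreover have "(LINT s|lborel. (norm (D s - p s))\<^sup>2) < \<epsilon>\<^sup>2"
    proof -
      have "(LINT s|lebesgue. (norm (D s - p s))\<^sup>2) = (LINT s|lborel. (norm (D s - p s))\<^sup>2)"
        by (rule integral_completion) measurable
      then have "sqrt (LINT s|lborel. (norm (D s - p s))\<^sup>2) < \<epsilon>"
        using close unfolding L2_norm_def by simp
      then have "(sqrt (LINT s|lborel. (norm (D s - p s))\<^sup>2))\<^sup>2 < \<epsilon>\<^sup>2"
        by (intro power_strict_mono) auto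
      then show ?thesis by simp
    qed
    ultimately show ?thesis by simp
  qed
  have "?I \<le> 0"
  proof (rule ccontr)
    assume "\<not> ?I \<le> 0"
    then show False using small[of "sqrt ?I"] by simp
  qed
  then have "?I = 0" by (simp add: order.antisym)
  then show ?thesis using integral_nonneg_eq_0_iff_AE[OF adm_norm2[OF adm_D]] by simp
qed

text \<open>An integrable function vanishes almost everywhere once its integrals over all Borel sets vanish.
Closed sets are an intersection-stable generator, so it suffices to treat them, and the indicator of
a closed set is a pointwise limit of continuous functions.\<close>

lemma integrable_zero_if_orthogonal_continuous:
  fixes \<phi> :: "'a::euclidean_space \<Rightarrow> complex"
  assumes \<phi>: "integrable lborel \<phi>"
    and orth: "\<And>q :: 'a \<Rightarrow> real. continuous_on UNIV q \<Longrightarrow> (\<And>t. 0 \<le> q t \<and> q t \<le> 1) \<Longrightarrow>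
      (LINT t|lborel. q t *\<^sub>R \<phi> t) = 0"
  shows "AE t in lborel. \<phi> t = 0"
proof (rule sigma_finite_measure.density_zero[OF sigma_finite_lborel \<phi>])
  have [measurable]: "\<phi> \<in> borel_measurable borel" using \<phi> by auto
  have total: "(LINT t|lborel. \<phi> t) = 0" using orth[of "\<lambda>_. 1"] by simp
  have closed: "(LINT t:C|lborel. \<phi> t) = 0" if C: "closed C" for C :: "'a set"
  proof (cases "C = {}")
    case True
    then show ?thesis by (simp add: set_lebesgue_integral_def)
  next
    case False
    define q where "q n t = max 0 (1 - real n * infdist t C)" for n t
    have q01: "0 \<le> q n t \<and> q n t \<le> 1" for n t by (simp add: q_def infdist_nonneg)
    have qc: "continuous_on UNIV (q n)" for n
      unfolding q_def by (intro continuous_intros)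
    then have [measurable]: "q n \<in> borel_measurable borel" for n
      by (intro borel_measurable_continuous_onI)
    have [measurable]: "C \<in> sets borel" using C by simp
    have lim: "(\<lambda>n. q n t) \<longlonglongrightarrow> indicator C t" for t
    proof (cases "t \<in> C")
      case True
      then show ?thesis by (simp add: q_def)
    next
      case out: False
      then have pos: "infdist t C > 0" using infdist_pos_not_in_closed[OF C False out] by simp
      obtain N where N: "1 / infdist t C < real N" using reals_Archimedean2 by blast
      have "q n t = 0" if "n \<ge> N" for n
      proof -
        have "1 / infdist t C < real n" using N that by linarith
        then show ?thesis using pos by (simp add: q_def field_simps)
      qed
      then have "\<forall>\<^sub>F n in sequentially. q n t = 0" by (auto simp: eventually_sequentially)
      then have "(\<lambda>n. q n t) \<longlonglongrightarrow> 0" by (rule tendsto_eventually)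
      then show ?thesis using out by simp
    qed
    have "(\<lambda>n. LINT t|lborel. q n t *\<^sub>R \<phi> t) \<longlonglongrightarrow> (LINT t|lborel. indicator C t *\<^sub>R \<phi> t)"
    proof (rule integral_dominated_convergence[where w = "\<lambda>t. norm (\<phi> t)"])
      show "AE t in lborel. (\<lambda>n. q n t *\<^sub>R \<phi> t) \<longlonglongrightarrow> indicator C t *\<^sub>R \<phi> t"
        by (intro AE_I2 tendsto_scaleR lim tendsto_const)
      show "AE t in lborel. norm (q n t *\<^sub>R \<phi> t) \<le> norm (\<phi> t)" for n
        using q01[of n] by (auto intro!: AE_I2 mult_left_le_one_le)
    qed (use \<phi> in auto)
    moreover have "(LINT t|lborel. q n t *\<^sub>R \<phi> t) = 0" for n
      using qc q01 by (intro orth)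
    ultimately have "(\<lambda>n::nat. 0) \<longlonglongrightarrow> (LINT t:C|lborel. \<phi> t)"
      by (simp only: set_lebesgue_integral_def)
    then show ?thesis by (simp add: LIMSEQ_const_iff)
  qed
  have int: "set_integrable lborel A \<phi>" if "A \<in> sets lborel" for A
    unfolding set_integrable_def using that \<phi> by (rule integrable_mult_indicator)
  fix A :: "'a set" assume "A \<in> sets lborel"
  then have A: "A \<in> sigma_sets UNIV (Collect closed)"
    by (simp add: borel_eq_closed)
  have meas: "A \<in> sets lborel" if "A \<in> sigma_sets UNIV (Collect closed)" for A :: "'a set"
    using that by (simp add: borel_eq_closed)
  have "Int_stable (Collect closed :: 'a set set)" and "Collect closed \<subseteq> Pow (UNIV :: 'a set)"
    by (auto simp: Int_stable_def)
  then show "(LINT t:A|lborel. \<phi> t) = 0"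
    using A
  proof (induction rule: sigma_sets_induct_disjoint)
    case (basic A)
    then show ?case using closed by simp
  next
    case empty
    then show ?case by (simp add: set_lebesgue_integral_def)
  next
    case (compl A)
    have "(LINT t:A \<union> (UNIV - A)|lborel. \<phi> t) =
        (LINT t:A|lborel. \<phi> t) + (LINT t:UNIV - A|lborel. \<phi> t)"
      using meas[OF compl(1)] by (intro set_integral_Un int) auto
    then show ?case using compl total by (simp add: set_lebesgue_integral_def)
  next
    case (union A)
    have Ai: "A i \<in> sets lborel" for i using union(2) by (intro meas) blast
    then have "(\<Union>i. A i) \<in> sets lborel" by (intro sets.countable_UN) auto
    then have "(LINT t:(\<Union>i. A i)|lborel. \<phi> t) = (\<Sum>i. LINT t:A i|lborel. \<phi> t)"
      using union(1) Ai
      by (intro lebesgue_integral_countable_add int) (auto simp: disjoint_family_on_def)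
    then show ?case using union by simp
  qed
qed

lemma norm_le_max_norm:
  assumes "compact K" and "p \<in> C_on K"
  shows "norm (p t) \<le> max_norm K p"
proof -
  have "compact ((\<lambda>t. norm (p t)) ` K)"
    using assms unfolding C_on_def by (intro compact_continuous_image continuous_intros) auto
  then have bdd: "bdd_above (insert 0 ((\<lambda>t. norm (p t)) ` K))"
    by (simp add: bounded_imp_bdd_above compact_imp_bounded)
  have "norm (p t) \<in> insert 0 ((\<lambda>t. norm (p t)) ` K)"
    using assms(2) unfolding C_on_def by auto
  then show ?thesis unfolding max_norm_def by (rule cSup_upper[OF _ bdd])
qed

lemma borel_measurable_C_on:
  assumes "compact K" and "p \<in> C_on K"
  shows "p \<in> borel_measurable borel"
proof -
  have "(\<lambda>t. if t \<in> K then p t else 0) \<in> borel_measurable borel"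
    using assms by (intro borel_measurable_continuous_on_if) (auto simp: C_on_def borel_compact)
  moreover have "(\<lambda>t. if t \<in> K then p t else 0) = p"
    using assms(2) by (auto simp: C_on_def)
  ultimately show ?thesis by simp
qed

lemma C_on_lincomb:
  assumes "p \<in> C_on K" "q \<in> C_on K"
  shows "(\<lambda>t. c * p t + q t) \<in> C_on K"
  using assms unfolding C_on_def by (auto intro!: continuous_intros)

text \<open>Integration against \<open>\<phi>\<close> is a bounded functional on \<open>C_on K\<close>. If it vanishes on a complete system,
it vanishes on \<open>C_on K\<close>, and then the complex measure with density \<open>\<phi>\<close> is zero.\<close>

lemma integrable_zero_if_orthogonal_translates:
  fixes \<phi> :: "'a::euclidean_space \<Rightarrow> complex"
  assumes K: "compact K" and compl: "complete_in_C K (translates G \<Lambda>)"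
    and \<phi>: "integrable lborel \<phi>" and out: "\<And>t. t \<notin> K \<Longrightarrow> \<phi> t = 0"
    and orth: "\<And>l. l \<in> \<Lambda> \<Longrightarrow> (LINT t|lborel. \<phi> t * G (t - l)) = 0"
  shows "AE t in lborel. \<phi> t = 0"
proof (rule integrable_zero_if_orthogonal_continuous[OF \<phi>])
  have [measurable]: "\<phi> \<in> borel_measurable borel" using \<phi> by auto
  have int: "integrable lborel (\<lambda>t. \<phi> t * p t)" if p: "p \<in> C_on K" for p
  proof (rule Bochner_Integration.integrable_bound)
    show "integrable lborel (\<lambda>t. max_norm K p * norm (\<phi> t))" using \<phi> by simp
    have "norm (\<phi> t * p t) \<le> norm (max_norm K p * norm (\<phi> t))" for t
    proof -
      have "norm (p t) \<le> \<bar>max_norm K p\<bar>" using norm_le_max_norm[OF K p, of t] by simp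
      then show ?thesis using mult_right_mono[of "norm (p t)" "\<bar>max_norm K p\<bar>" "norm (\<phi> t)"]
        by (simp add: norm_mult abs_mult mult.commute)
    qed
    then show "AE t in lborel. norm (\<phi> t * p t) \<le> norm (max_norm K p * norm (\<phi> t))" by simp
    have [measurable]: "p \<in> borel_measurable borel" by (rule borel_measurable_C_on[OF K p])
    show "(\<lambda>t. \<phi> t * p t) \<in> borel_measurable lborel" by measurable
  qed
  have sub: "restrict0 K ` translates G \<Lambda> \<subseteq> C_on K"
    using compl by (simp add: complete_system_def)
  have span: "p \<in> C_on K \<and> (LINT t|lborel. \<phi> t * p t) = 0"
    if "p \<in> cfun.span (restrict0 K ` translates G \<Lambda>)" for p
  proof (rule span_induct_functions
      [OF that, where P = "\<lambda>p. p \<in> C_on K \<and> (LINT t|lborel. \<phi> t * p t) = 0"], goal_cases)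
    case 1
    show ?case by (simp add: C_on_def)
  next
    case (2 c b p)
    then obtain l where l: "l \<in> \<Lambda>" "b = restrict0 K (translation l G)"
      unfolding translates_def by auto
    have b: "b \<in> C_on K" using sub 2 by blast
    have "(\<lambda>t. \<phi> t * b t) = (\<lambda>t. \<phi> t * G (t - l))"
      using out by (auto simp: l(2) restrict0_def translation_def)
    then have "(LINT t|lborel. \<phi> t * b t) = 0" using orth[OF l(1)] by simp
    moreover have "(LINT t|lborel. \<phi> t * (c * b t + p t)) =
        (LINT t|lborel. c * (\<phi> t * b t) + \<phi> t * p t)"
      by (simp add: algebra_simps)
    moreover have "\<dots> = c * (LINT t|lborel. \<phi> t * b t) + (LINT t|lborel. \<phi> t * p t)"
      using int[OF b] int[of p] 2 by simp
    ultimately show ?case using 2 b C_on_lincomb[of b K p c] by simp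
  qed
  fix q :: "'a \<Rightarrow> real" assume q: "continuous_on UNIV q"
  let ?q = "restrict0 K (\<lambda>t. complex_of_real (q t))"
  have qC: "?q \<in> C_on K"
  proof -
    have "continuous_on K (\<lambda>t. complex_of_real (q t))"
      by (intro continuous_intros continuous_on_subset[OF q]) simp
    then show ?thesis unfolding C_on_def by (simp add: restrict0_def cong: continuous_on_cong)
  qed
  have small: "norm (LINT t|lborel. \<phi> t * ?q t) \<le> \<epsilon> * (LINT t|lborel. norm (\<phi> t))"
    if \<epsilon>: "\<epsilon> > 0" for \<epsilon>
  proof -
    obtain p where p: "p \<in> cfun.span (restrict0 K ` translates G \<Lambda>)"
      and close: "max_norm K (\<lambda>t. ?q t - p t) < \<epsilon>"
      using compl qC \<epsilon> unfolding complete_system_def by blast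
    have p': "p \<in> C_on K" "(LINT t|lborel. \<phi> t * p t) = 0" using span[OF p] by auto
    have diff: "(\<lambda>t. ?q t - p t) \<in> C_on K"
      using C_on_lincomb[OF p'(1) qC, of "-1"] by simp
    have "(LINT t|lborel. \<phi> t * ?q t) = (LINT t|lborel. \<phi> t * (?q t - p t))"
      using int[OF qC] int[OF p'(1)] p'(2) by (simp add: right_diff_distrib)
    also have "norm \<dots> \<le> (LINT t|lborel. norm (\<phi> t * (?q t - p t)))"
      by (rule integral_norm_bound)
    also have "\<dots> \<le> (LINT t|lborel. \<epsilon> * norm (\<phi> t))"
    proof (rule integral_mono)
      show "integrable lborel (\<lambda>t. norm (\<phi> t * (?q t - p t)))"
        using int[OF diff] by (rule integrable_norm)
      show "integrable lborel (\<lambda>t. \<epsilon> * norm (\<phi> t))" using \<phi> by simp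
      fix t
      have "norm (?q t - p t) \<le> \<epsilon>"
        using norm_le_max_norm[OF K diff, of t] close by simp
      then show "norm (\<phi> t * (?q t - p t)) \<le> \<epsilon> * norm (\<phi> t)"
        using mult_right_mono[of "norm (?q t - p t)" \<epsilon> "norm (\<phi> t)"]
        by (simp add: norm_mult mult.commute)
    qed
    finally show ?thesis by simp
  qed
  have "((\<lambda>\<epsilon>. \<epsilon> * (LINT t|lborel. norm (\<phi> t))) \<longlongrightarrow> 0 * (LINT t|lborel. norm (\<phi> t))) (at_right 0)"
    by (intro tendsto_intros)
  then have "norm (LINT t|lborel. \<phi> t * ?q t) \<le> 0 * (LINT t|lborel. norm (\<phi> t))"
    by (rule tendsto_lowerbound)
      (auto intro: eventually_mono[OF eventually_at_right_less[of 0]] small)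
  then have "(LINT t|lborel. \<phi> t * ?q t) = 0" by simp
  moreover have "(\<lambda>t. \<phi> t * ?q t) = (\<lambda>t. q t *\<^sub>R \<phi> t)"
    using out by (auto simp: restrict0_def scaleR_conv_of_real)
  ultimately show "(LINT t|lborel. q t *\<^sub>R \<phi> t) = 0" by simp
qed

section \<open>Windowed functions on a compact set\<close>

lemma integrable_if_square_integrable_compact_support:
  fixes F :: "'a::euclidean_space \<Rightarrow> complex"
  assumes K: "compact K" and F[measurable]: "F \<in> borel_measurable borel"
    and sq: "integrable lborel (\<lambda>t. (norm (F t))\<^sup>2)" and out: "\<And>t. t \<notin> K \<Longrightarrow> F t = 0"
  shows "integrable lborel F"
proof (rule Bochner_Integration.integrable_bound)
  have "K \<in> sets borel" using K by (rule borel_compact)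
  then have "integrable lborel (indicator K :: 'a \<Rightarrow> real)"
    using emeasure_compact_finite[OF K] by simp
  with sq show "integrable lborel (\<lambda>t. indicator K t + (norm (F t))\<^sup>2)" by simp
  have "norm (F t) \<le> norm (indicator K t + (norm (F t))\<^sup>2)" for t
  proof (cases "t \<in> K")
    case True
    have "norm (F t) * 2 \<le> 1 + (norm (F t))\<^sup>2"
      using sum_squares_bound[of "norm (F t)" 1] by simp
    then have "norm (F t) \<le> 1 + (norm (F t))\<^sup>2" using norm_ge_zero[of "F t"] by linarith
    then show ?thesis using True by simp
  qed (use out in simp)
  then show "AE t in lborel. norm (F t) \<le> norm (indicator K t + (norm (F t))\<^sup>2)" by simp
qed measurable

text \<open>On \<open>K\<close> the translated window is bounded by compactness, and off \<open>K\<close> the product is zero.\<close>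

lemma square_integrable_windowed:
  fixes F g :: "'a::euclidean_space \<Rightarrow> complex"
  assumes K: "compact K" and g: "continuous_on UNIV g" and F[measurable]: "F \<in> borel_measurable borel"
    and sq: "integrable lborel (\<lambda>t. (norm (F t))\<^sup>2)" and out: "\<And>t. t \<notin> K \<Longrightarrow> F t = 0"
  shows "integrable lborel (\<lambda>t. (norm (F t * cnj (g (t - l))))\<^sup>2)"
proof -
  have [measurable]: "g \<in> borel_measurable borel" using g by (rule borel_measurable_continuous_onI)
  have "compact ((\<lambda>t. g (t - l)) ` K)"
    by (intro compact_continuous_image[OF _ K] continuous_on_compose2[OF g] continuous_intros) auto
  then have "bounded ((\<lambda>t. g (t - l)) ` K)" by (rule compact_imp_bounded)
  then obtain B where B: "\<And>t. t \<in> K \<Longrightarrow> norm (g (t - l)) \<le> B"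
    unfolding bounded_iff by blast
  show ?thesis
  proof (rule Bochner_Integration.integrable_bound)
    show "integrable lborel (\<lambda>t. (norm (F t))\<^sup>2 * B\<^sup>2)" using sq by simp
    have "(norm (F t * cnj (g (t - l))))\<^sup>2 \<le> (norm (F t))\<^sup>2 * B\<^sup>2" for t
      using out[of t] B[of t]
      by (cases "t \<in> K") (auto simp: norm_mult power_mult_distrib intro!: mult_left_mono power_mono)
    then show "AE t in lborel. norm ((norm (F t * cnj (g (t - l))))\<^sup>2) \<le> norm ((norm (F t))\<^sup>2 * B\<^sup>2)"
      by simp
    show "(\<lambda>t. (norm (F t * cnj (g (t - l))))\<^sup>2) \<in> borel_measurable lborel" by measurable
  qed
qed

text \<open>This continuity lets a countable dense set of translation parameters stand for all of them, which
is what makes an exceptional null set independent of the parameter.\<close>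

lemma continuous_on_integral_translate:
  fixes \<phi> G :: "'a::euclidean_space \<Rightarrow> complex"
  assumes K: "compact K" and \<phi>: "integrable lborel \<phi>" and out: "\<And>t. t \<notin> K \<Longrightarrow> \<phi> t = 0"
    and G: "continuous_on UNIV G"
  shows "continuous_on UNIV (\<lambda>l. LINT t|lborel. \<phi> t * G (t - l))"
proof (rule continuous_at_imp_continuous_on, intro ballI)
  have [measurable]: "\<phi> \<in> borel_measurable borel" "G \<in> borel_measurable borel"
    using \<phi> G by (auto intro: borel_measurable_continuous_onI)
  fix l :: 'a
  show "isCont (\<lambda>l. LINT t|lborel. \<phi> t * G (t - l)) l"
    unfolding continuous_at_sequentially comp_def
  proof (intro allI impI)
    fix x assume x: "x \<longlonglongrightarrow> l"
    have "compact {a - b | a b. a \<in> K \<and> b \<in> insert l (range x)}"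
      by (intro compact_differences K compact_sequence_with_limit x)
    then have "compact (G ` {a - b | a b. a \<in> K \<and> b \<in> insert l (range x)})"
      by (intro compact_continuous_image continuous_on_subset[OF G]) auto
    then have "bounded (G ` {a - b | a b. a \<in> K \<and> b \<in> insert l (range x)})"
      by (rule compact_imp_bounded)
    then obtain B where B': "\<forall>y \<in> G ` {a - b | a b. a \<in> K \<and> b \<in> insert l (range x)}. norm y \<le> B"
      unfolding bounded_iff by blast
    have B: "norm (G (a - x n)) \<le> B" if "a \<in> K" for a n
      using that by (intro B'[rule_format]) blast
    show "(\<lambda>n. LINT t|lborel. \<phi> t * G (t - x n)) \<longlonglongrightarrow> (LINT t|lborel. \<phi> t * G (t - l))"
    proof (rule integral_dominated_convergence[where w = "\<lambda>t. norm (\<phi> t) * B"])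
      show "AE t in lborel. (\<lambda>n. \<phi> t * G (t - x n)) \<longlonglongrightarrow> \<phi> t * G (t - l)"
      proof (rule AE_I2)
        fix t
        have "isCont G (t - l)" using G by (simp add: continuous_on_eq_continuous_at)
        then have "(\<lambda>n. G (t - x n)) \<longlonglongrightarrow> G (t - l)"
          by (rule isCont_tendsto_compose) (intro tendsto_intros x)
        then show "(\<lambda>n. \<phi> t * G (t - x n)) \<longlonglongrightarrow> \<phi> t * G (t - l)"
          by (intro tendsto_intros)
      qed
      have "norm (\<phi> t * G (t - x n)) \<le> norm (\<phi> t) * B" for n t
        using out[of t] B[of t n] by (cases "t \<in> K") (auto simp: norm_mult intro: mult_left_mono)
      then show "AE t in lborel. norm (\<phi> t * G (t - x n)) \<le> norm (\<phi> t) * B" for n by simp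
    qed (use \<phi> in auto)
  qed
qed

section \<open>Equality of spectrograms and of autocorrelation kernels\<close>

text \<open>The autocorrelation of \<open>f(t) cnj(g(t - l))\<close> at \<open>s\<close> is the integral of \<open>f(t) cnj(f(t - s))\<close> against
the translate by \<open>l\<close> of \<open>shift_product g s\<close>. So for fixed \<open>l\<close> the completeness of the exponentials
shows that the function \<open>\<phi> s\<close> below is orthogonal to that translate for almost every \<open>s\<close>, and then
for fixed \<open>s\<close> the completeness of the translates shows \<open>\<phi> s = 0\<close>.\<close>

lemma equal_spectrograms_imp_equal_kernels:
  fixes f h g :: "'a::euclidean_space \<Rightarrow> complex"
  assumes K: "compact K"
    and expo: "complete_in_L2 (minkowski_diff K K) (exponentials \<Gamma>)"
    and g: "continuous_on UNIV g"
    and trans: "\<And>\<omega>. \<omega> \<in> minkowski_diff K K \<Longrightarrow> complete_in_C K (translates (shift_product g \<omega>) \<Lambda>)"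
    and f[measurable]: "f \<in> borel_measurable borel" and f2: "integrable lborel (\<lambda>t. (norm (f t))\<^sup>2)"
    and f0: "\<And>t. t \<notin> K \<Longrightarrow> f t = 0"
    and h[measurable]: "h \<in> borel_measurable borel" and h2: "integrable lborel (\<lambda>t. (norm (h t))\<^sup>2)"
    and h0: "\<And>t. t \<notin> K \<Longrightarrow> h t = 0"
    and eq: "\<And>l \<gamma>. l \<in> \<Lambda> \<Longrightarrow> \<gamma> \<in> \<Gamma> \<Longrightarrow>
      norm (LINT t|lborel. f t * cnj (g (t - l)) * cnj (plane_wave \<gamma> t)) =
      norm (LINT t|lborel. h t * cnj (g (t - l)) * cnj (plane_wave \<gamma> t))"
  shows "AE u in lborel. AE t in lborel. f t * cnj (f u) = h t * cnj (h u)"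
proof -
  have [measurable]: "g \<in> borel_measurable borel" using g by (rule borel_measurable_continuous_onI)
  define W where "W F l t = F t * cnj (g (t - l))" for F l t
  have W: "W F l \<in> borel_measurable borel" "integrable lborel (\<lambda>t. (norm (W F l t))\<^sup>2)"
    "\<And>t. t \<notin> K \<Longrightarrow> W F l t = 0" "integrable lborel (W F l)" if F: "F \<in> {f, h}" for F l
  proof -
    have [measurable]: "F \<in> borel_measurable borel" using F by auto
    show m: "W F l \<in> borel_measurable borel" unfolding W_def[abs_def] by measurable
    show s: "integrable lborel (\<lambda>t. (norm (W F l t))\<^sup>2)"
      using F f2 h2 f0 h0 unfolding W_def by (intro square_integrable_windowed[OF K g]) auto
    show o: "\<And>t. t \<notin> K \<Longrightarrow> W F l t = 0" using F f0 h0 by (auto simp: W_def)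
    show "integrable lborel (W F l)"
      using K m s o by (rule integrable_if_square_integrable_compact_support)
  qed
  note Wf = W[of f, simplified] and Wh = W[of h, simplified]
  define \<phi> where "\<phi> s t = f t * cnj (f (t - s)) - h t * cnj (h (t - s))" for s t
  define D where "D l s = autocorrelation (W f l) s - autocorrelation (W h l) s" for l s
  have D_alt: "D l s = (LINT t|lborel. \<phi> s t * shift_product g s (t - l))" for l s
  proof -
    have "D l s = (LINT t|lborel. W f l t * cnj (W f l (t - s)) - W h l t * cnj (W h l (t - s)))"
      unfolding D_def autocorrelation_def
      using integrable_shifted_square[OF Wf(1,2)] integrable_shifted_square[OF Wh(1,2)] by simp
    also have "\<dots> = (LINT t|lborel. \<phi> s t * shift_product g s (t - l))"
      unfolding W_def \<phi>_def shift_product_def by (simp add: algebra_simps)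
    finally show ?thesis .
  qed
  have "AE s in lborel. D l s = 0" if l: "l \<in> \<Lambda>" for l
  proof (rule bounded_orthogonal_exponentials_zero[OF _ expo])
    show "compact (minkowski_diff K K)"
      unfolding minkowski_diff_def using K K by (rule compact_differences)
    show "D l \<in> borel_measurable borel"
      unfolding D_def[abs_def] using Wf(1) Wh(1) by measurable
    show "D l s = 0" if "s \<notin> minkowski_diff K K" for s
      using autocorrelation_outside[of K "W f l" s] autocorrelation_outside[of K "W h l" s] Wf Wh that
      by (simp add: D_def)
    show "norm (D l s) \<le> 2 * (LINT t|lborel. (norm (W f l t))\<^sup>2) + 2 * (LINT t|lborel. (norm (W h l t))\<^sup>2)" for s
      using norm_triangle_ineq4[of "autocorrelation (W f l) s" "autocorrelation (W h l) s"]
        norm_autocorrelation_le[OF Wf(1,2), of l s] norm_autocorrelation_le[OF Wh(1,2), of l s]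
      unfolding D_def by linarith
    show "(LINT s|lborel. D l s * cnj (plane_wave \<gamma> s)) = 0" if \<gamma>: "\<gamma> \<in> \<Gamma>" for \<gamma>
    proof -
      have "(LINT s|lborel. D l s * cnj (plane_wave \<gamma> s)) =
          (LINT s|lborel. autocorrelation (W f l) s * cnj (plane_wave \<gamma> s)) -
          (LINT s|lborel. autocorrelation (W h l) s * cnj (plane_wave \<gamma> s))"
        unfolding D_def left_diff_distrib
        by (intro Bochner_Integration.integral_diff integrable_autocorrelation_wave Wf(4) Wh(4))
      also have "\<dots> = 0"
        unfolding fourier_autocorrelation[OF Wf(4)] fourier_autocorrelation[OF Wh(4)]
        using eq[OF l \<gamma>] by (simp add: W_def)
      finally show ?thesis .
    qed
  qed
  \<comment> \<open>The null set of bad \<open>s\<close> depends on \<open>l\<close>, and \<open>\<Lambda>\<close> may be uncountable.\<close>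
  moreover obtain \<Lambda>' where \<Lambda>': "countable \<Lambda>'" "\<Lambda>' \<subseteq> \<Lambda>" "\<Lambda> \<subseteq> closure \<Lambda>'"
    by (rule separable)
  ultimately have "AE s in lborel. \<forall>l\<in>\<Lambda>'. D l s = 0"
    by (subst AE_ball_countable) auto
  then have "AE s in lborel. AE t in lborel. \<phi> s t = 0"
  proof (rule eventually_mono)
    fix s assume D0: "\<forall>l\<in>\<Lambda>'. D l s = 0"
    have int: "integrable lborel (\<phi> s)"
      unfolding \<phi>_def
      using integrable_shifted_square[OF f f2] integrable_shifted_square[OF h h2] by simp
    have out: "\<phi> s t = 0" if "t \<notin> K" for t using that f0 h0 by (simp add: \<phi>_def)
    have "continuous_on UNIV (shift_product g s)"
      unfolding shift_product_def
      by (intro continuous_intros g continuous_on_compose2[OF g]) auto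
    then have "continuous_on UNIV (\<lambda>l. LINT t|lborel. \<phi> s t * shift_product g s (t - l))"
      by (intro continuous_on_integral_translate[OF K int out])
    then have cont: "continuous_on (closure \<Lambda>') (\<lambda>l. D l s)"
      unfolding D_alt by (rule continuous_on_subset) simp
    have orth: "(LINT t|lborel. \<phi> s t * shift_product g s (t - l)) = 0" if "l \<in> \<Lambda>" for l
      unfolding D_alt[symmetric]
      using continuous_constant_on_closure[OF cont, of 0 l] D0 \<Lambda>'(3) that by auto
    show "AE t in lborel. \<phi> s t = 0"
    proof (cases "s \<in> minkowski_diff K K")
      case True
      show ?thesis
        by (rule integrable_zero_if_orthogonal_translates[OF K trans[OF True] int out orth])
    next
      case False
      have "\<phi> s t = 0" for t
      proof -
        have "t \<notin> K \<or> t - s \<notin> K"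
        proof (rule ccontr)
          assume "\<not> ?thesis"
          then have "s \<in> minkowski_diff K K"
            unfolding minkowski_diff_def mem_Collect_eq
            by (intro exI[of _ t] exI[of _ "t - s"]) simp
          with False show False by contradiction
        qed
        then show ?thesis using f0 h0 by (auto simp: \<phi>_def)
      qed
      then show ?thesis by simp
    qed
  qed
  then have "AE t in lborel. AE s in lborel. \<phi> s t = 0"
  proof (subst lborel_pair.AE_commute)
    show "{x \<in> space (lborel \<Otimes>\<^sub>M lborel). \<phi> (snd x) (fst x) = 0} \<in> sets (lborel \<Otimes>\<^sub>M lborel)"
      unfolding \<phi>_def by measurable
  qed
  then have "AE t in lborel. AE u in lborel. f t * cnj (f u) = h t * cnj (h u)"
  proof (rule eventually_mono)
    fix t assume "AE s in lborel. \<phi> s t = 0"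
    then have "AE s in distr lborel borel (\<lambda>s. t - s). \<phi> s t = 0"
      by (simp only: lborel_distr_reflect)
    then have "AE u in lborel. \<phi> (t - u) t = 0"
      by (rule AE_distrD[rotated]) measurable
    then show "AE u in lborel. f t * cnj (f u) = h t * cnj (h u)"
      by (simp add: \<phi>_def)
  qed
  then show ?thesis
  proof (subst lborel_pair.AE_commute)
    show "{x \<in> space (lborel \<Otimes>\<^sub>M lborel). f (snd x) * cnj (f (fst x)) = h (snd x) * cnj (h (fst x))}
        \<in> sets (lborel \<Otimes>\<^sub>M lborel)"
      by measurable
  qed
qed

section \<open>Recovery of a function from its rank-one kernel\<close>

lemma AE_nonzero_witness:
  assumes "AE u in M. P u" and "\<not> (AE u in M. f u = 0)"
  shows "\<exists>u. P u \<and> f u \<noteq> 0"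
  using assms by (metis (mono_tags, lifting) eventually_mono)

text \<open>Freezing one variable \<open>u\<close> with \<open>f u \<noteq> 0\<close> in the identity exhibits \<open>f\<close> as a multiple \<open>c h\<close>; inserting
\<open>f = c h\<close> into the identity again forces \<open>c cnj c = 1\<close>. This needs points with
\<open>f u \<noteq> 0\<close>; if \<open>f\<close> vanishes almost everywhere, the identity makes \<open>h\<close> vanish as well.\<close>

lemma rank_one_kernel_determines_function:
  fixes f h :: "'a::euclidean_space \<Rightarrow> complex"
  assumes kernel: "AE u in lborel. AE t in lborel. f t * cnj (f u) = h t * cnj (h u)"
  shows "\<exists>c. norm c = 1 \<and> (AE t in lborel. f t = c * h t)"
proof (cases "AE t in lborel. f t = 0")
  case f0: True
  have "AE t in lborel. h t = 0"
  proof (rule ccontr)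
    assume h: "\<not> (AE t in lborel. h t = 0)"
    obtain u where u: "AE t in lborel. f t * cnj (f u) = h t * cnj (h u)" "h u \<noteq> 0"
      using AE_nonzero_witness[OF kernel h] by blast
    from u(1) f0 have "AE t in lborel. h t = 0"
      by eventually_elim (use u(2) in simp)
    with h show False by contradiction
  qed
  with f0 have "AE t in lborel. f t = 1 * h t" by eventually_elim simp
  then show ?thesis using norm_one by blast
next
  case f: False
  obtain u where u: "AE t in lborel. f t * cnj (f u) = h t * cnj (h u)" "f u \<noteq> 0"
    using AE_nonzero_witness[OF kernel f] by blast
  define c where "c = cnj (h u) / cnj (f u)"
  from u(1) have fch: "AE t in lborel. f t = c * h t"
    by eventually_elim (use u(2) in \<open>simp add: c_def field_simps\<close>)
  obtain v where v: "AE t in lborel. f t * cnj (f v) = h t * cnj (h v)" "f v = c * h v" "f v \<noteq> 0"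
    using AE_nonzero_witness[OF eventually_conj[OF kernel fch] f] by blast
  obtain t where t: "f t * cnj (f v) = h t * cnj (h v)" "f t = c * h t" "f t \<noteq> 0"
    using AE_nonzero_witness[OF eventually_conj[OF v(1) fch] f] by blast
  have nz: "h t * cnj (h v) \<noteq> 0" using v(2,3) t(2,3) by (metis complex_cnj_zero_iff mult_eq_0_iff)
  have "(c * cnj c) * (h t * cnj (h v)) = h t * cnj (h v)"
    using t(1) unfolding t(2) v(2) by (simp add: algebra_simps)
  then have "c * cnj c = 1" using nz by simp
  then have "(norm c)\<^sup>2 = 1" by (metis complex_norm_square of_real_eq_1_iff)
  then have "norm c = 1 \<or> norm c = - 1" by (simp only: power2_eq_1_iff)
  then have "norm c = 1" using norm_ge_zero[of c] by linarith
  with fch show ?thesis by blast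
qed

section \<open>Uniqueness of phase retrieval\<close>

text \<open>Elements of \<open>L2_on K\<close> are only Lebesgue measurable and vanish off \<open>K\<close> almost everywhere. A Borel
version that vanishes off \<open>K\<close> everywhere allows shifts and products \<open>f(t) cnj(f(t - s))\<close> to be handled
as jointly measurable functions on the product of two copies of Borel-Lebesgue measure.\<close>

lemma L2_on_borel_representative:
  fixes f :: "'a::euclidean_space \<Rightarrow> complex"
  assumes K: "closed K" and f: "f \<in> L2_on K"
  obtains f' where "f' \<in> borel_measurable borel" "integrable lborel (\<lambda>t. (norm (f' t))\<^sup>2)"
    "\<And>t. t \<notin> K \<Longrightarrow> f' t = 0" "AE t in lborel. f t = f' t"
    "\<And>q. q \<in> borel_measurable borel \<Longrightarrow> (LINT t|lebesgue. f t * q t) = (LINT t|lborel. f' t * q t)"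
proof -
  have fm[measurable]: "f \<in> borel_measurable lebesgue"
    and f2: "integrable lebesgue (\<lambda>t. (norm (f t))\<^sup>2)"
    using f by (auto simp: L2_on_def L2_def)
  have "AE t in lebesgue. t \<notin> K \<longrightarrow> f t = 0"
    using f ess_supp_subset_iff[OF K, of f] by (simp add: L2_on_def)
  then have out: "AE t in lborel. t \<notin> K \<longrightarrow> f t = 0" by (simp add: AE_completion_iff)
  have "(\<lambda>t. Re (f t)) \<in> borel_measurable lebesgue" "(\<lambda>t. Im (f t)) \<in> borel_measurable lebesgue"
    by measurable
  then obtain a b where [measurable]: "a \<in> borel_measurable lborel" "b \<in> borel_measurable lborel"
    and ab: "AE t in lborel. Re (f t) = a t" "AE t in lborel. Im (f t) = b t"
    by (blast dest: completion_ex_borel_measurable_real)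
  have [measurable]: "K \<in> sets borel" using K by simp
  define f' where "f' t = (if t \<in> K then Complex (a t) (b t) else 0)" for t
  have f'_alt: "f' = (\<lambda>t. if t \<in> K then of_real (a t) + \<i> * of_real (b t) else 0)"
    by (simp add: fun_eq_iff f'_def Complex_eq)
  have [measurable]: "f' \<in> borel_measurable borel" unfolding f'_alt by measurable
  have ae: "AE t in lborel. f t = f' t"
    using out ab by eventually_elim (auto simp: f'_def complex_eq_iff)
  then have ae': "AE t in lebesgue. f t = f' t" by (rule AE_completion)
  have leb [measurable]: "f' \<in> borel_measurable lebesgue" by (simp add: measurable_completion)
  show thesis
  proof (rule that)
    show "f' \<in> borel_measurable borel" by fact
    have "integrable lebesgue (\<lambda>t. (norm (f' t))\<^sup>2)"
      using f2 ae' by (subst integrable_cong_AE[where g = "\<lambda>t. (norm (f t))\<^sup>2"]) auto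
    then show "integrable lborel (\<lambda>t. (norm (f' t))\<^sup>2)"
      by (subst (asm) integrable_completion) auto
    fix q :: "'a \<Rightarrow> complex" assume [measurable]: "q \<in> borel_measurable borel"
    have [measurable]: "q \<in> borel_measurable lebesgue" by (simp add: measurable_completion)
    have "(LINT t|lebesgue. f t * q t) = (LINT t|lebesgue. f' t * q t)"
      using ae' by (intro integral_cong_AE) auto
    also have "\<dots> = (LINT t|lborel. f' t * q t)"
      by (rule integral_completion) measurable
    finally show "(LINT t|lebesgue. f t * q t) = (LINT t|lborel. f' t * q t)" .
  qed (use ae in \<open>auto simp: f'_def\<close>)
qed

theorem theorem2p1:
  fixes K \<Gamma> \<Lambda> :: "(real ^ 'd) set" and g :: "real ^ 'd \<Rightarrow> complex"
  assumes "compact K"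
    and "complete_in_L2 (minkowski_diff K K) (exponentials \<Gamma>)"
    and "continuous_on UNIV g"
    and "\<And>\<omega>. \<omega> \<in> minkowski_diff K K \<Longrightarrow> complete_in_C K (translates (shift_product g \<omega>) \<Lambda>)"
  shows "phase_retrieval_uniqueness_set g (L2_on K) (\<Lambda> \<times> \<Gamma>)"
  unfolding phase_retrieval_uniqueness_set_def
proof (intro ballI impI)
  fix f h assume f: "f \<in> L2_on K" and h: "h \<in> L2_on K"
    and eq: "\<forall>u\<in>\<Lambda> \<times> \<Gamma>. norm (stft g f u) = norm (stft g h u)"
  have K: "closed K" using assms(1) by (rule compact_imp_closed)
  have [measurable]: "g \<in> borel_measurable borel"
    using assms(3) by (rule borel_measurable_continuous_onI)
  have kernel: "(\<lambda>t. cnj (g (t - l)) * cnj (plane_wave \<gamma> t)) \<in> borel_measurable borel" for l \<gamma>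
    by measurable
  have stft: "stft g F (l, \<gamma>) = (LINT t|lebesgue. F t * (cnj (g (t - l)) * cnj (plane_wave \<gamma> t)))"
    for F l \<gamma>
    by (simp only: stft_def cnj_plane_wave prod.case mult.assoc)
  obtain f' where f': "f' \<in> borel_measurable borel" "integrable lborel (\<lambda>t. (norm (f' t))\<^sup>2)"
    "\<And>t. t \<notin> K \<Longrightarrow> f' t = 0" and f_eq: "AE t in lborel. f t = f' t"
    and f_int: "\<And>q. q \<in> borel_measurable borel \<Longrightarrow>
      (LINT t|lebesgue. f t * q t) = (LINT t|lborel. f' t * q t)"
    by (rule L2_on_borel_representative[OF K f]) blast
  obtain h' where h': "h' \<in> borel_measurable borel" "integrable lborel (\<lambda>t. (norm (h' t))\<^sup>2)"
    "\<And>t. t \<notin> K \<Longrightarrow> h' t = 0" and h_eq: "AE t in lborel. h t = h' t"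
    and h_int: "\<And>q. q \<in> borel_measurable borel \<Longrightarrow>
      (LINT t|lebesgue. h t * q t) = (LINT t|lborel. h' t * q t)"
    by (rule L2_on_borel_representative[OF K h]) blast
  have "norm (LINT t|lborel. f' t * cnj (g (t - l)) * cnj (plane_wave \<gamma> t)) =
      norm (LINT t|lborel. h' t * cnj (g (t - l)) * cnj (plane_wave \<gamma> t))"
    if "l \<in> \<Lambda>" "\<gamma> \<in> \<Gamma>" for l \<gamma>
    using eq[rule_format, of "(l, \<gamma>)"] that
    by (simp only: stft f_int[OF kernel] h_int[OF kernel] mult.assoc mem_Times_iff fst_conv snd_conv)
  then have "AE u in lborel. AE t in lborel. f' t * cnj (f' u) = h' t * cnj (h' u)"
    using f' h' by (intro equal_spectrograms_imp_equal_kernels[OF assms])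
  then obtain c where c: "norm c = 1" "AE t in lborel. f' t = c * h' t"
    using rank_one_kernel_determines_function by blast
  from c(2) f_eq h_eq have "AE t in lborel. f t = c * h t" by eventually_elim simp
  with c(1) show "\<exists>c. norm c = 1 \<and> (AE t in lebesgue. f t = c * h t)"
    by (auto intro: AE_completion)
qed

end
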